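(* Under nearest rounding, let $\tilde z\in\mathbb R$ with $|\tilde z|\le(M-1)\times\beta^{E_{\max}}$ (i.e., $\tilde z$ does not overflow in $\mathbb D$). If $z=fl(\tilde z)$ admits a representation $z=m(z)\times\beta^{e(z)}$ in $\mathbb D$, then, expressing $\tilde z$ as $\tilde z=\zeta\times\beta^{e(z)}$ with $\zeta\in\mathbb R$, we have $$m(z)=round(\zeta),$$ where $round(\zeta)\in\mathbb Z$ is the nearest integer to $\zeta$, with a tie-breaking criterion, if needed, consistent with that used for $fl(\tilde z)$.
   Context: Dekker's floating point number system: let $\beta>1$, $t\ge 1$, $E_{\min}\le E_{\max}$ be integers and $M=\beta^t$. Then $\mathbb D=\{x\in\mathbb R : x=m(x)\times\beta^{e(x)},\ m(x)\in\mathbb Z,\ |m(x)|<M,\ e(x)\in\mathbb Z,\ E_{\min}\le e(x)\le E_{\max}\}$. A pair $(m(x),e(x))$ satisfying these constraints is a representation of $x$; a number may admit several representations. Nearest rounding: $fl:\mathbb R\to\mathbb D$ satisfies $|fl(r)-r|\le|a-r|$ for all $a\in\mathbb D$, with ties resolved by a fixed deterministic tie-breaking criterion depending on the input only. Consistency of tie-breaking means that ties are resolved in the same direction: if $\zeta$ lies exactly midway between the consecutive integers $k$ and $k+1$, and $fl(\tilde z)$ is one of the two numbers $k\times\beta^{e(z)}$, $(k+1)\times\beta^{e(z)}$, then $round(\zeta)$ is the corresponding one of $k$, $k+1$. *)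

theory Defs
  imports Complex_Main
begin

definition dekker_rep :: "int \<Rightarrow> nat \<Rightarrow> int \<Rightarrow> int \<Rightarrow> real \<Rightarrow> int \<Rightarrow> int \<Rightarrow> bool" where
  "dekker_rep \<beta> t Emin Emax x m e \<longleftrightarrow>
     x = of_int m * of_int \<beta> powi e \<and> \<bar>m\<bar> < \<beta> ^ t \<and> Emin \<le> e \<and> e \<le> Emax"

definition dekker_system :: "int \<Rightarrow> nat \<Rightarrow> int \<Rightarrow> int \<Rightarrow> real set" where
  "dekker_system \<beta> t Emin Emax = {x. \<exists>m e. dekker_rep \<beta> t Emin Emax x m e}"

text \<open>The tie-breaking rule is arbitrary; that it is deterministic and depends on the input only
  is expressed by \<open>fl\<close> (respectively \<open>rnd\<close> below) being a function.\<close>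

definition nearest_rounding :: "real set \<Rightarrow> (real \<Rightarrow> real) \<Rightarrow> bool" where
  "nearest_rounding D fl \<longleftrightarrow> (\<forall>r. fl r \<in> D \<and> (\<forall>a\<in>D. \<bar>fl r - r\<bar> \<le> \<bar>a - r\<bar>))"

text \<open>The library function \<^const>\<open>round\<close> always resolves ties upwards, so it is only one instance
  of the following.\<close>

definition nearest_int_rounding :: "(real \<Rightarrow> int) \<Rightarrow> bool" where
  "nearest_int_rounding rnd \<longleftrightarrow> (\<forall>x. \<forall>k::int. \<bar>of_int (rnd x) - x\<bar> \<le> \<bar>of_int k - x\<bar>)"

text \<open>Consistency is required only at the given \<open>zt = \<zeta> * \<beta> powi e\<close>: the direction in which
  \<open>fl\<close> resolves a tie may depend on the exponent, so one \<open>rnd\<close> need not be consistent with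
  \<open>fl\<close> for all exponents at once.\<close>

definition consistent_ties ::
  "int \<Rightarrow> (real \<Rightarrow> real) \<Rightarrow> (real \<Rightarrow> int) \<Rightarrow> real \<Rightarrow> real \<Rightarrow> int \<Rightarrow> bool" where
  "consistent_ties \<beta> fl rnd zt \<zeta> e \<longleftrightarrow>
     (\<forall>k::int. \<zeta> = of_int k + 1 / 2 \<longrightarrow>
        (fl zt = of_int k * of_int \<beta> powi e \<longrightarrow> rnd \<zeta> = k) \<and>
        (fl zt = of_int (k + 1) * of_int \<beta> powi e \<longrightarrow> rnd \<zeta> = k + 1))"

end

theory Submission
  imports Defs
begin

text \<open>
  In units of \<open>\<beta> powi e\<close>, the number \<open>m\<close> is at least as close to \<open>\<zeta>\<close> as each of its
  neighbours \<open>m - 1\<close> and \<open>m + 1\<close>: such a neighbour \<open>k\<close> gives an element of the system, unless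
  \<open>\<bar>k\<bar> = \<beta> ^ t\<close> and \<open>e = Emax\<close>, and then the absence of overflow puts \<open>k\<close> farther away from
  \<open>\<zeta>\<close> than the extremal mantissa of the same sign. Hence \<open>\<bar>m - \<zeta>\<bar> \<le> 1 / 2\<close>, and a nearest
  integer to \<open>\<zeta>\<close> can differ from \<open>m\<close> only in a tie.
\<close>

lemma mem_dekker_systemI:
  assumes "\<bar>k\<bar> < \<beta> ^ t" "Emin \<le> e" "e \<le> Emax"
  shows "of_int k * of_int \<beta> powi e \<in> dekker_system \<beta> t Emin Emax"
  using assms unfolding dekker_system_def dekker_rep_def by blast

text \<open>A mantissa of modulus \<open>\<beta> ^ t\<close> is one too large, but
  \<open>t \<ge> 1\<close> makes it divisible by \<open>\<beta>\<close>. Moving one factor into the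
  exponent gives an admissible representation, and \<open>e < Emax\<close> leaves room for
  this.\<close>

lemma mem_dekker_system_power:
  assumes "\<beta> > 1" "t \<ge> 1" "\<bar>k\<bar> = \<beta> ^ t" "Emin \<le> e" "e < Emax"
  shows "of_int k * of_int \<beta> powi e \<in> dekker_system \<beta> t Emin Emax"
proof -
  obtain s where t: "t = Suc s"
    using \<open>t \<ge> 1\<close> by (cases t) auto
  have "k = (sgn k * \<beta> ^ s) * \<beta>"
    using \<open>\<bar>k\<bar> = \<beta> ^ t\<close> t by (metis mult.assoc mult.commute power_Suc sgn_mult_abs)
  then have "(of_int k :: real) = of_int (sgn k * \<beta> ^ s) * of_int \<beta>"
    by (metis of_int_mult)
  then have "(of_int k :: real) * of_int \<beta> powi e
      = of_int (sgn k * \<beta> ^ s) * of_int \<beta> powi (e + 1)"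
    using \<open>\<beta> > 1\<close> by (simp add: power_int_add)
  moreover have "\<bar>sgn k * \<beta> ^ s\<bar> < \<beta> ^ t"
    using \<open>\<beta> > 1\<close> t by (simp add: abs_mult sgn_if)
  ultimately show ?thesis
    using mem_dekker_systemI[of "sgn k * \<beta> ^ s" \<beta> t Emin "e + 1" Emax] assms by simp
qed

text \<open>The bound on \<open>k\<close> is not strict, so that both neighbours of \<open>m\<close>
  are covered even when \<open>\<bar>m\<bar> = \<beta> ^ t - 1\<close>.\<close>

lemma nearest_mantissa:
  fixes \<zeta> :: real
  assumes "\<beta> > 1" "t \<ge> 1"
    and fl: "nearest_rounding (dekker_system \<beta> t Emin Emax) fl"
    and no_overflow: "\<bar>\<zeta> * of_int \<beta> powi e\<bar> \<le> (of_int \<beta> ^ t - 1) * of_int \<beta> powi Emax"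
    and rep: "dekker_rep \<beta> t Emin Emax (fl (\<zeta> * of_int \<beta> powi e)) m e"
    and "\<bar>k\<bar> \<le> \<beta> ^ t"
  shows "\<bar>of_int m - \<zeta>\<bar> \<le> \<bar>of_int k - \<zeta>\<bar>"
proof -
  define b where "b = (of_int \<beta> :: real) powi e"
  have "b > 0"
    using \<open>\<beta> > 1\<close> by (simp add: b_def zero_less_power_int)
  have e: "Emin \<le> e" "e \<le> Emax" and fl_eq: "fl (\<zeta> * b) = of_int m * b"
    using rep by (auto simp: dekker_rep_def b_def)
  have le: "\<bar>of_int m - \<zeta>\<bar> \<le> \<bar>of_int j - \<zeta>\<bar>"
    if "of_int j * of_int \<beta> powi e \<in> dekker_system \<beta> t Emin Emax" for j
  proof -
    have "\<bar>of_int m * b - \<zeta> * b\<bar> \<le> \<bar>of_int j * b - \<zeta> * b\<bar>"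
      using fl that fl_eq unfolding nearest_rounding_def b_def by metis
    then show ?thesis
      using \<open>b > 0\<close> by (simp add: left_diff_distrib[symmetric] abs_mult)
  qed
  consider "\<bar>k\<bar> < \<beta> ^ t" | "\<bar>k\<bar> = \<beta> ^ t" "e < Emax" | "\<bar>k\<bar> = \<beta> ^ t" "e = Emax"
    using \<open>\<bar>k\<bar> \<le> \<beta> ^ t\<close> e by linarith
  then show ?thesis
  proof cases
    case 1
    then show ?thesis using le mem_dekker_systemI e by blast
  next
    case 2
    then show ?thesis using le mem_dekker_system_power assms(1,2) e by blast
  next
    case 3
    have k: "\<bar>of_int k :: real\<bar> = of_int \<beta> ^ t"
      using 3(1) by (metis of_int_abs of_int_power)
    \<comment> \<open>Since \<open>e = Emax\<close>, the power in the overflow bound is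
      \<open>b\<close> itself and cancels.\<close>
    have \<zeta>: "\<bar>\<zeta>\<bar> \<le> of_int \<beta> ^ t - 1"
      using no_overflow \<open>b > 0\<close> 3(2) by (simp add: b_def abs_mult)
    have "k \<noteq> 0" "\<bar>k - sgn k\<bar> < \<beta> ^ t"
      using 3(1) \<open>\<beta> > 1\<close> by (auto simp: sgn_if split: if_splits)
    then have "\<bar>of_int m - \<zeta>\<bar> \<le> \<bar>of_int (k - sgn k) - \<zeta>\<bar>"
      using le mem_dekker_systemI e by blast
    \<comment> \<open>On the side of \<open>k\<close>, \<open>\<zeta>\<close> does not lie beyond
      \<open>k - sgn k\<close>, so the step from \<open>k\<close> towards zero shortens the distance
      by exactly 1.\<close>
    also have "\<dots> \<le> \<bar>of_int k - \<zeta>\<bar>"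
      using k \<zeta> \<open>k \<noteq> 0\<close> \<open>\<beta> > 1\<close>
      by (cases "k > 0") (auto simp: sgn_if)
    finally show ?thesis .
  qed
qed

theorem lemma2p11:
  fixes \<beta> Emin Emax m e :: int and t :: nat
    and fl :: "real \<Rightarrow> real" and rnd :: "real \<Rightarrow> int"
    and zt z \<zeta> :: real
  assumes "\<beta> > 1" and "t \<ge> 1" and "Emin \<le> Emax"
    and "nearest_rounding (dekker_system \<beta> t Emin Emax) fl"
    and "\<bar>zt\<bar> \<le> (of_int \<beta> ^ t - 1) * of_int \<beta> powi Emax"
    and "z = fl zt"
    and "dekker_rep \<beta> t Emin Emax z m e"
    and "zt = \<zeta> * of_int \<beta> powi e"
    and "nearest_int_rounding rnd"
    and "consistent_ties \<beta> fl rnd zt \<zeta> e"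
  shows "m = rnd \<zeta>"
proof (rule ccontr)
  assume neq: "m \<noteq> rnd \<zeta>"
  have m: "\<bar>m\<bar> < \<beta> ^ t" and fl_eq: "fl zt = of_int m * of_int \<beta> powi e"
    using assms(6,7) by (auto simp: dekker_rep_def)
  have near: "\<bar>of_int m - \<zeta>\<bar> \<le> \<bar>of_int k - \<zeta>\<bar>" if "\<bar>k\<bar> \<le> \<beta> ^ t" for k
    using nearest_mantissa[of \<beta> t Emin Emax fl \<zeta> e m k] assms that by auto
  have "\<bar>of_int m - \<zeta>\<bar> \<le> \<bar>of_int (m + 1) - \<zeta>\<bar>" "\<bar>of_int m - \<zeta>\<bar> \<le> \<bar>of_int (m - 1) - \<zeta>\<bar>"
    using m by (intro near; linarith)+
  then have m_half: "\<bar>of_int m - \<zeta>\<bar> \<le> 1 / 2"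
    by (simp add: abs_if split: if_splits)
  have rnd_le: "\<bar>of_int (rnd \<zeta>) - \<zeta>\<bar> \<le> \<bar>of_int m - \<zeta>\<bar>"
    using assms(9) by (simp add: nearest_int_rounding_def)
  have tie: "(fl zt = of_int k * of_int \<beta> powi e \<longrightarrow> rnd \<zeta> = k) \<and>
      (fl zt = of_int (k + 1) * of_int \<beta> powi e \<longrightarrow> rnd \<zeta> = k + 1)"
    if "\<zeta> = of_int k + 1 / 2" for k
    using assms(10) that unfolding consistent_ties_def by blast
  show False
  proof (cases "m < rnd \<zeta>")
    case True
    \<comment> \<open>Two integers at least 1 apart and both within \<open>1 / 2\<close> of
      \<open>\<zeta>\<close> force \<open>\<zeta>\<close> to be their midpoint. Here
      \<open>m\<close> is the lower one, so the first clause of \<open>tie\<close> applies.\<close>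
    then have "of_int m + 1 \<le> (of_int (rnd \<zeta>) :: real)" by linarith
    then have "\<zeta> = of_int m + 1 / 2" using m_half rnd_le by linarith
    then show False using tie[of m] fl_eq neq by simp
  next
    case False
    \<comment> \<open>Now \<open>m\<close> is the upper endpoint of the tie, so \<open>tie\<close>
      is used at \<open>m - 1\<close> with its second clause.\<close>
    then have "of_int (rnd \<zeta>) + 1 \<le> (of_int m :: real)" using neq by linarith
    then have "\<zeta> = of_int (m - 1) + 1 / 2" using m_half rnd_le by (simp; linarith)
    then show False using tie[of "m - 1"] fl_eq neq by simp
  qed
qed

end
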